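(* Let $XYZ$ be a relation word with maximal piece prefix $X$, middle word $Y$ and maximal piece suffix $Z$, and let $\overline{X}\,\overline{Y}\,\overline{Z}$ be the other side of its relation, factorised likewise. Suppose $u = XYu'$ where $XY$ is a clean overlap prefix of $u$, and let $v$ be a word. Then $u \equiv v$ if and only if one of the following mutually exclusive conditions holds: (1) $u = XYZu''$ and $v = XYZv''$ and either $Zu'' \equiv Zv''$ or $\overline{Z}u'' \equiv \overline{Z}v''$ or both; (2) $u = XYu'$, $v = XYv'$, and $Z$ fails to be a prefix of at least one of $u'$ and $v'$, and $u' \equiv v'$; (3) $u = XYZu''$, $v = \overline{X}\,\overline{Y}\,\overline{Z}v''$ and either $Zu'' \equiv Zv''$ or $\overline{Z}u'' \equiv \overline{Z}v''$ or both; (4) $u = XYu'$, $v = \overline{X}\,\overline{Y}\,\overline{Z}v''$ but $Z$ is not a prefix of $u'$ and $u' \equiv Zv''$; (5) $u = XYZu''$, $v = \overline{X}\,\overline{Y}v'$ but $\overline{Z}$ is not a prefix of $v'$ and $\overline{Z}u'' \equiv v'$; (6) $u = XYu'$, $v = \overline{X}\,\overline{Y}v'$, $Z$ is not a prefix of $u'$ and $\overline{Z}$ is not a prefix of $v'$, but $Z = z_1z$, $\overline{Z} = z_2z$, $u' = z_1u''$, $v' = z_2v''$ where $u'' \equiv v''$ and $z$ is the maximal common suffix of $Z$ and $\overline{Z}$, $z$ is non-empty, and $z$ is a possible prefix of $u''$. (In each condition, $u'', v', v'', z_1, z_2, z$ are words whose existence is part of the condition.)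
   Context: Fix a finite monoid presentation $\langle \mathscr{A}\mid\mathscr{R}\rangle$. Words are elements of $\mathscr{A}^*$, with empty word $\epsilon$; $u = v$ means equality in the free monoid and $u \equiv v$ means that $u,v$ represent the same element of the presented monoid. A word $p$ is a possible prefix of $u$ if there is a (possibly empty) word $w$ with $pw \equiv u$. A relation word is a word occurring as one side of a relation. A piece is a word which occurs as a factor in sides of two different relations, or as a factor of both sides of a relation, or in two different (possibly overlapping) places within one side of a relation; by convention $\epsilon$ is always a piece. The presentation satisfies $C(n)$ if no relation word is a product of strictly fewer than $n$ pieces. Assume the presentation satisfies $C(4)$. For a relation word $R$ let $X_R$ and $Z_R$ be the longest prefix and the longest suffix of $R$ which are pieces; then $R = X_RY_RZ_R$ with $Y_R$ non-empty and not a piece. $X_R, Y_R, Z_R$ are the maximal piece prefix, middle word and maximal piece suffix of $R$. Letters $X,Y,Z$ with a common subscript or adornment always denote these factors of a single relation word. For a relation word $R$, $\overline{R}$ is the (unique) word such that $(R,\overline{R})$ or $(\overline{R},R)$ is a relation, and $\overline{X},\overline{Y},\overline{Z}$ are the corresponding factors of $\overline{R}$ when $R = XYZ$. A relation prefix of a word is a prefix of the form $aXY$, with $X,Y$ the maximal piece prefix and middle word of some relation word (this factorisation is unique). An overlap prefix of a word is a relation prefix admitting a factorisation $bX_1Y_1'X_2Y_2'\cdots X_{n-1}Y_{n-1}'X_nY_n$ with $n \geq 1$, where no factor of the form $X_0Y_0$ (maximal piece prefix times middle word of some relation word) begins before the end of the prefix $b$, each $X_iY_iZ_i$ ($1\le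 i\le n$) is a relation word with maximal piece prefix $X_i$ and maximal piece suffix $Z_i$, and for $1 \leq i < n$, $Y_i'$ is a proper non-empty prefix of $Y_i$. A relation prefix $aXY$ of $u$ is clean if $u$ does not have a prefix $aXY'X_1Y_1$ where $X_1,Y_1$ are the maximal piece prefix and middle word of some relation word and $Y'$ is a proper non-empty prefix of $Y$. *)

theory Defs
  imports Main "HOL-Library.Sublist"
begin

text \<open>
  A presentation is given by an alphabet \<open>A\<close> and a set \<open>Rel\<close> of pairs of words over \<open>A\<close>.
  Words are lists, and a factor of a word is a contiguous sublist (\<open>sublist\<close>).
\<close>

definition finite_presentation :: "'a set \<Rightarrow> ('a list \<times> 'a list) set \<Rightarrow> bool" where
  "finite_presentation A Rel \<longleftrightarrow> finite A \<and> finite Rel \<and> Rel \<subseteq> lists A \<times> lists A"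

inductive pres_eq :: "'a set \<Rightarrow> ('a list \<times> 'a list) set \<Rightarrow> 'a list \<Rightarrow> 'a list \<Rightarrow> bool"
  for A :: "'a set" and Rel :: "('a list \<times> 'a list) set" where
  rel: "(l, r) \<in> Rel \<Longrightarrow> pres_eq A Rel l r"
| refl: "w \<in> lists A \<Longrightarrow> pres_eq A Rel w w"
| sym: "pres_eq A Rel u v \<Longrightarrow> pres_eq A Rel v u"
| trans: "pres_eq A Rel u v \<Longrightarrow> pres_eq A Rel v w \<Longrightarrow> pres_eq A Rel u w"
| mult: "pres_eq A Rel u v \<Longrightarrow> pres_eq A Rel u' v' \<Longrightarrow> pres_eq A Rel (u @ u') (v @ v')"

definition possible_prefix ::
    "'a set \<Rightarrow> ('a list \<times> 'a list) set \<Rightarrow> 'a list \<Rightarrow> 'a list \<Rightarrow> bool" where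
  "possible_prefix A Rel p u \<longleftrightarrow> (\<exists>w \<in> lists A. pres_eq A Rel (p @ w) u)"

definition relation_words :: "('a list \<times> 'a list) set \<Rightarrow> 'a list set" where
  "relation_words Rel = fst ` Rel \<union> snd ` Rel"

definition opposite_sides :: "('a list \<times> 'a list) set \<Rightarrow> 'a list \<Rightarrow> 'a list \<Rightarrow> bool" where
  "opposite_sides Rel w w' \<longleftrightarrow> (w, w') \<in> Rel \<or> (w', w) \<in> Rel"

definition piece :: "('a list \<times> 'a list) set \<Rightarrow> 'a list \<Rightarrow> bool" where
  "piece Rel p \<longleftrightarrow>
     p = [] \<or>
     (\<exists>r \<in> Rel. \<exists>s \<in> Rel. r \<noteq> s \<and>
        (sublist p (fst r) \<or> sublist p (snd r)) \<and> (sublist p (fst s) \<or> sublist p (snd s))) \<or>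
     (\<exists>r \<in> Rel. sublist p (fst r) \<and> sublist p (snd r)) \<or>
     (\<exists>w \<in> relation_words Rel. \<exists>a b c d. w = a @ p @ b \<and> w = c @ p @ d \<and> a \<noteq> c)"

definition small_overlap :: "nat \<Rightarrow> ('a list \<times> 'a list) set \<Rightarrow> bool" where
  "small_overlap n Rel \<longleftrightarrow>
     (\<forall>w \<in> relation_words Rel.
        \<not> (\<exists>ps. length ps < n \<and> (\<forall>p \<in> set ps. piece Rel p) \<and> w = concat ps))"

definition max_piece_prefix :: "('a list \<times> 'a list) set \<Rightarrow> 'a list \<Rightarrow> 'a list \<Rightarrow> bool" where
  "max_piece_prefix Rel x w \<longleftrightarrow>
     prefix x w \<and> piece Rel x \<and> (\<forall>x'. prefix x' w \<and> piece Rel x' \<longrightarrow> length x' \<le> length x)"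

definition max_piece_suffix :: "('a list \<times> 'a list) set \<Rightarrow> 'a list \<Rightarrow> 'a list \<Rightarrow> bool" where
  "max_piece_suffix Rel z w \<longleftrightarrow>
     suffix z w \<and> piece Rel z \<and> (\<forall>z'. suffix z' w \<and> piece Rel z' \<longrightarrow> length z' \<le> length z)"

text \<open>
  \<open>XYZ\<close> is a relation word with maximal piece prefix \<open>X\<close>, middle word \<open>Y\<close> and maximal
  piece suffix \<open>Z\<close>.
\<close>
definition relation_factors ::
    "('a list \<times> 'a list) set \<Rightarrow> 'a list \<Rightarrow> 'a list \<Rightarrow> 'a list \<Rightarrow> bool" where
  "relation_factors Rel X Y Z \<longleftrightarrow>
     X @ Y @ Z \<in> relation_words Rel \<and>
     max_piece_prefix Rel X (X @ Y @ Z) \<and> max_piece_suffix Rel Z (X @ Y @ Z)"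

definition relation_prefix :: "('a list \<times> 'a list) set \<Rightarrow> 'a list \<Rightarrow> 'a list \<Rightarrow> bool" where
  "relation_prefix Rel p u \<longleftrightarrow>
     prefix p u \<and> (\<exists>a X Y Z. relation_factors Rel X Y Z \<and> p = a @ X @ Y)"

text \<open>
  The words \<open>X\<^sub>1Y\<^sub>1'X\<^sub>2Y\<^sub>2' \<dots> X\<^sub>nY\<^sub>n\<close> with \<open>n \<ge> 1\<close>, where each \<open>Y\<^sub>i'\<close>
  is a proper non-empty prefix of \<open>Y\<^sub>i\<close>.
\<close>
inductive overlap_chain :: "('a list \<times> 'a list) set \<Rightarrow> 'a list \<Rightarrow> bool"
  for Rel :: "('a list \<times> 'a list) set" where
  last: "relation_factors Rel X Y Z \<Longrightarrow> overlap_chain Rel (X @ Y)"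
| step: "relation_factors Rel X Y Z \<Longrightarrow> strict_prefix Y' Y \<Longrightarrow> Y' \<noteq> [] \<Longrightarrow>
    overlap_chain Rel w \<Longrightarrow> overlap_chain Rel (X @ Y' @ w)"

text \<open>
  The last conjunct says that no factor \<open>X\<^sub>0Y\<^sub>0\<close> of \<open>p\<close> begins before the end of \<open>b\<close>.
\<close>
definition overlap_prefix :: "('a list \<times> 'a list) set \<Rightarrow> 'a list \<Rightarrow> 'a list \<Rightarrow> bool" where
  "overlap_prefix Rel p u \<longleftrightarrow>
     relation_prefix Rel p u \<and>
     (\<exists>b w. p = b @ w \<and> overlap_chain Rel w \<and>
        \<not> (\<exists>c d X\<^sub>0 Y\<^sub>0 Z\<^sub>0. relation_factors Rel X\<^sub>0 Y\<^sub>0 Z\<^sub>0 \<and>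
              p = c @ X\<^sub>0 @ Y\<^sub>0 @ d \<and> length c < length b))"

text \<open>Cleanness of the relation prefix \<open>aXY\<close> of \<open>u\<close>.\<close>
definition clean ::
    "('a list \<times> 'a list) set \<Rightarrow> 'a list \<Rightarrow> 'a list \<Rightarrow> 'a list \<Rightarrow> 'a list \<Rightarrow> bool" where
  "clean Rel a X Y u \<longleftrightarrow>
     \<not> (\<exists>Y' X\<^sub>1 Y\<^sub>1 Z\<^sub>1. strict_prefix Y' Y \<and> Y' \<noteq> [] \<and> relation_factors Rel X\<^sub>1 Y\<^sub>1 Z\<^sub>1 \<and>
          prefix (a @ X @ Y' @ X\<^sub>1 @ Y\<^sub>1) u)"

definition max_common_suffix :: "'a list \<Rightarrow> 'a list \<Rightarrow> 'a list \<Rightarrow> bool" where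
  "max_common_suffix z v w \<longleftrightarrow>
     suffix z v \<and> suffix z w \<and> (\<forall>z'. suffix z' v \<and> suffix z' w \<longrightarrow> length z' \<le> length z)"

end

theory Submission
  imports Defs
begin

text \<open>
  Under \<open>C(4)\<close> a word \<open>XYZw\<close> can only be rewritten inside its tail \<open>Zw\<close> or by exchanging
  \<open>XYZ\<close> with the other side of its relation: a relation word invading \<open>Y\<close> would contain, or be
  covered by, a suffix of \<open>YZ\<close> longer than the maximal piece suffix \<open>Z\<close>. Cleanness of \<open>XY\<close>
  rules out such an invasion also before \<open>Z\<close> has appeared. Hence equality of words reduces to
  alternating equalities \<open>Zw \<equiv> Zw'\<close> and \<open>Zbw \<equiv> Zbw'\<close> of tails, where \<open>Zb\<close> is
  the suffix of the other side. If a derivation from \<open>Zw\<close> and one from \<open>Zbw\<close> both touch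
  these pieces, they do so within a common suffix of \<open>Z\<close> and \<open>Zb\<close>; therefore alternating
  equalities collapse to a single one, and the six cases record which tails display \<open>Z\<close> or \<open>Zb\<close>.
\<close>

section \<open>Equal concatenations and rewriting by single relations\<close>

text \<open>The overlap in the second case is non-empty, so the cases exclude each other; later
  arguments use this to tell two positions apart.\<close>

lemma append_eq_appendE:
  assumes "a @ b = c @ d"
  obtains (longer) e where "a = c @ e" "d = e @ b" | (shorter) e where "c = a @ e" "b = e @ d" "e \<noteq> []"
proof -
  from assms consider e where "a = c @ e" "d = e @ b" | e where "c = a @ e" "b = e @ d"
    by (auto simp: append_eq_append_conv2)
  then show thesis using that by (metis append_Nil append_Nil2)
qed

text \<open>The alphabet is left out, so that the combinatorics need not track letters, and
  \<open>opposite_sides\<close> makes every step reversible.\<close>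

definition rewrite_step :: "('a list \<times> 'a list) set \<Rightarrow> 'a list \<Rightarrow> 'a list \<Rightarrow> bool" where
  "rewrite_step Rel u v \<longleftrightarrow>
     (\<exists>a l r b. opposite_sides Rel l r \<and> u = a @ l @ b \<and> v = a @ r @ b)"

abbreviation rewrite_eq :: "('a list \<times> 'a list) set \<Rightarrow> 'a list \<Rightarrow> 'a list \<Rightarrow> bool" where
  "rewrite_eq Rel \<equiv> (rewrite_step Rel)\<^sup>*\<^sup>*"

lemma opposite_sides_sym: "opposite_sides Rel l r \<Longrightarrow> opposite_sides Rel r l"
  by (auto simp: opposite_sides_def)

lemma opposite_sides_relation_words:
  "opposite_sides Rel l r \<Longrightarrow> l \<in> relation_words Rel"
  by (force simp: opposite_sides_def relation_words_def)

lemma rewrite_step_sym: "rewrite_step Rel u v \<Longrightarrow> rewrite_step Rel v u"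
  unfolding rewrite_step_def using opposite_sides_sym by blast

lemma rewrite_step_append: "rewrite_step Rel u v \<Longrightarrow> rewrite_step Rel (a @ u @ b) (a @ v @ b)"
  unfolding rewrite_step_def by (metis append.assoc)

lemma rewrite_step_opposite: "opposite_sides Rel l r \<Longrightarrow> rewrite_step Rel (a @ l @ b) (a @ r @ b)"
  unfolding rewrite_step_def by blast

lemma rewrite_steps_sym: "(rewrite_step Rel ^^ n) u v \<Longrightarrow> (rewrite_step Rel ^^ n) v u"
proof (induction n arbitrary: v)
  case (Suc n)
  then obtain w where "(rewrite_step Rel ^^ n) u w" "rewrite_step Rel w v" by auto
  then show ?case using Suc.IH rewrite_step_sym by (metis relpowp_Suc_I2)
qed auto

lemma rewrite_eq_sym: "rewrite_eq Rel u v \<Longrightarrow> rewrite_eq Rel v u"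
  by (metis rewrite_steps_sym rtranclp_imp_relpowp relpowp_imp_rtranclp)

lemma rewrite_eq_append:
  "rewrite_eq Rel u v \<Longrightarrow> rewrite_eq Rel (a @ u @ b) (a @ v @ b)"
  by (induction rule: rtranclp_induct) (auto intro: rtranclp.rtrancl_into_rtrancl rewrite_step_append)

lemma rewrite_eq_append_left: "rewrite_eq Rel u v \<Longrightarrow> rewrite_eq Rel (a @ u) (a @ v)"
  using rewrite_eq_append[of Rel u v a "[]"] by simp

lemma rewrite_eq_append_right: "rewrite_eq Rel u v \<Longrightarrow> rewrite_eq Rel (u @ b) (v @ b)"
  using rewrite_eq_append[of Rel u v "[]" b] by simp

lemma rewrite_eq_lists:
  assumes "finite_presentation A Rel" "rewrite_eq Rel u v" "u \<in> lists A"
  shows "v \<in> lists A"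
  using assms(2,3)
proof (induction rule: rtranclp_induct)
  case (step y z)
  then show ?case
    using assms(1) unfolding rewrite_step_def opposite_sides_def finite_presentation_def by fastforce
qed

text \<open>Trades the inductive congruence for chains of single replacements, on which induction
  step by step is possible. The alphabet matters only at the ends, since relations are words over
  \<open>A\<close> and steps never leave it.\<close>

lemma pres_eq_iff_rewrite_eq:
  assumes "finite_presentation A Rel"
  shows "pres_eq A Rel u v \<longleftrightarrow> u \<in> lists A \<and> v \<in> lists A \<and> rewrite_eq Rel u v"
proof
  assume "pres_eq A Rel u v"
  then show "u \<in> lists A \<and> v \<in> lists A \<and> rewrite_eq Rel u v"
  proof induction
    case (rel l r)
    then have "rewrite_step Rel l r"
      using rewrite_step_opposite[of Rel l r "[]" "[]"] by (simp add: opposite_sides_def)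
    then show ?case using rel assms by (auto simp: finite_presentation_def)
  next
    case (sym u v)
    then show ?case using rewrite_eq_sym by blast
  next
    case (mult u v u' v')
    then have "rewrite_eq Rel (u @ u') (v @ u')" "rewrite_eq Rel (v @ u') (v @ v')"
      using rewrite_eq_append_left rewrite_eq_append_right by blast+
    then show ?case using mult by auto
  qed auto
next
  assume "u \<in> lists A \<and> v \<in> lists A \<and> rewrite_eq Rel u v"
  then have u: "u \<in> lists A" and "rewrite_eq Rel u v" by auto
  from this(2) show "pres_eq A Rel u v"
  proof (induction rule: rtranclp_induct)
    case base
    then show ?case using u by (rule pres_eq.refl)
  next
    case (step y z)
    then obtain a l r b where o: "opposite_sides Rel l r" and yz: "y = a @ l @ b" "z = a @ r @ b"
      unfolding rewrite_step_def by blast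
    have "pres_eq A Rel l r" using o by (auto simp: opposite_sides_def intro: pres_eq.intros)
    moreover have "y \<in> lists A" using rewrite_eq_lists[OF assms step.hyps(1) u] .
    ultimately have "pres_eq A Rel y z" unfolding yz
      by (auto intro!: pres_eq.mult pres_eq.refl)
    then show ?case using step.IH pres_eq.trans by blast
  qed
qed

section \<open>Pieces and unique occurrences\<close>

lemma piece_sublist: "piece Rel p \<Longrightarrow> sublist q p \<Longrightarrow> piece Rel q"
proof -
  assume p: "piece Rel p" and q: "sublist q p"
  then obtain x y where xy: "p = x @ q @ y" by (auto simp: sublist_def)
  have "\<exists>a b c d. w = a @ q @ b \<and> w = c @ q @ d \<and> a \<noteq> c"
    if "w = a @ p @ b" "w = c @ p @ d" "a \<noteq> c" for w a b c d
  proof -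
    have "w = (a @ x) @ q @ (y @ b) \<and> w = (c @ x) @ q @ (y @ d) \<and> a @ x \<noteq> c @ x"
      using that xy by simp
    then show ?thesis by blast
  qed
  moreover have "sublist q w" if "sublist p w" for w
    using q that by (rule sublist_order.order_trans)
  moreover have "q = []" if "p = []" using q that by simp
  ultimately show ?thesis using p unfolding piece_def by meson
qed

lemma nonpiece_occurrence_relation:
  assumes "\<not> piece Rel p" "r \<in> Rel" "s \<in> Rel"
    "sublist p (fst r) \<or> sublist p (snd r)" "sublist p (fst s) \<or> sublist p (snd s)"
  shows "r = s" "\<not> (sublist p (fst r) \<and> sublist p (snd r))"
  using assms unfolding piece_def by blast+

text \<open>Occurrences in two relations, or in both sides of one, would make \<open>p\<close> a
  piece, so the two words agree; two positions inside that word would again make \<open>p\<close> a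
  piece. Most contradictions below arise from a second position of a non-piece.\<close>

lemma nonpiece_occurrence:
  assumes p: "\<not> piece Rel p" and "a @ p @ b \<in> relation_words Rel" "c @ p @ d \<in> relation_words Rel"
  shows "a = c \<and> b = d"
proof -
  obtain r s where rs: "r \<in> Rel" "s \<in> Rel"
    and "a @ p @ b = fst r \<or> a @ p @ b = snd r" "c @ p @ d = fst s \<or> c @ p @ d = snd s"
    using assms unfolding relation_words_def by fastforce
  moreover have "sublist p (a @ p @ b)" "sublist p (c @ p @ d)" by simp_all
  ultimately have "a @ p @ b = c @ p @ d"
    using nonpiece_occurrence_relation[OF p rs] by metis
  moreover from this have "a = c" using p assms(2) unfolding piece_def by metis
  ultimately show ?thesis by simp
qed

section \<open>Consequences of C(4) for relation words\<close>

locale c4 =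
  fixes Rel :: "('a list \<times> 'a list) set"
  assumes c4: "small_overlap 4 Rel"
begin

abbreviation eqv (infix "\<approx>" 50) where "u \<approx> v \<equiv> rewrite_eq Rel u v"

lemma not_three_pieces:
  assumes "p @ q @ r \<in> relation_words Rel" "piece Rel p" "piece Rel q" "piece Rel r"
  shows False
proof -
  have "length [p, q, r] < 4 \<and> (\<forall>x \<in> set [p, q, r]. piece Rel x) \<and> p @ q @ r = concat [p, q, r]"
    using assms by simp
  then show False using c4 assms(1) unfolding small_overlap_def by blast
qed

lemma piece_Nil: "piece Rel []"
  by (simp add: piece_def)

lemma not_two_pieces:
  "p @ q \<in> relation_words Rel \<Longrightarrow> piece Rel p \<Longrightarrow> piece Rel q \<Longrightarrow> False"
  using not_three_pieces[of p q "[]"] piece_Nil by simp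

lemma relation_word_not_piece: "R \<in> relation_words Rel \<Longrightarrow> \<not> piece Rel R"
  using not_two_pieces[of R "[]"] piece_Nil by auto

text \<open>A relation word is not a piece under C(4), so it lies in one relation and on one side of
  it only; hence the other side is well defined.\<close>

lemma opposite_sides_unique:
  assumes "opposite_sides Rel R S" "opposite_sides Rel R S'"
  shows "S = S'"
proof -
  have np: "\<not> piece Rel R"
    using assms(1) opposite_sides_relation_words relation_word_not_piece by blast
  from assms(1) obtain r where r: "r \<in> Rel" "r = (R, S) \<or> r = (S, R)" by (auto simp: opposite_sides_def)
  from assms(2) obtain s where s: "s \<in> Rel" "s = (R, S') \<or> s = (S', R)" by (auto simp: opposite_sides_def)
  have "sublist R (fst r) \<or> sublist R (snd r)" "sublist R (fst s) \<or> sublist R (snd s)"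
    using r(2) s(2) by auto
  then show ?thesis
    using nonpiece_occurrence_relation[OF np r(1) s(1)] r(2) s(2) by auto
qed

lemma relation_factors_word: "relation_factors Rel X Y Z \<Longrightarrow> X @ Y @ Z \<in> relation_words Rel"
  by (simp add: relation_factors_def)

lemma relation_factors_pieces:
  assumes "relation_factors Rel X Y Z"
  shows "piece Rel X" "piece Rel Z"
  using assms by (auto simp: relation_factors_def max_piece_prefix_def max_piece_suffix_def)

lemma middle_not_piece: "relation_factors Rel X Y Z \<Longrightarrow> \<not> piece Rel Y"
  using not_three_pieces relation_factors_word relation_factors_pieces by blast

lemma prefix_middle_not_piece: "relation_factors Rel X Y Z \<Longrightarrow> \<not> piece Rel (X @ Y)"
  using middle_not_piece piece_sublist sublist_append_rightI by blast

lemma piece_prefix_le: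
  assumes "relation_factors Rel X Y Z" "X @ Y @ Z = p @ m" "piece Rel p"
  obtains r where "X = p @ r" "m = r @ Y @ Z"
proof -
  have "length p \<le> length X"
    using assms unfolding relation_factors_def max_piece_prefix_def by auto
  then show thesis using that assms(2) by (auto simp: append_eq_append_conv2)
qed

text \<open>The form in which maximality of \<open>Z\<close> is used: a suffix of
  \<open>Y @ Z\<close> reaching into \<open>Y\<close> has only one place in the relation
  words.\<close>

lemma suffix_extension_not_piece:
  assumes "relation_factors Rel X Y Z" "Y = Y' @ t" "t \<noteq> []"
  shows "\<not> piece Rel (t @ Z)"
proof
  assume "piece Rel (t @ Z)"
  moreover have "suffix (t @ Z) (X @ Y @ Z)" using assms(2) by (auto simp: suffix_def)
  ultimately have "length (t @ Z) \<le> length Z"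
    using assms(1) unfolding relation_factors_def max_piece_suffix_def by blast
  then show False using assms(3) by simp
qed

lemma relation_factors_exist:
  assumes R: "R \<in> relation_words Rel"
  obtains X Y Z where "relation_factors Rel X Y Z" "R = X @ Y @ Z"
proof -
  obtain X where X: "max_piece_prefix Rel X R"
  proof -
    have "prefix [] R \<and> piece Rel []" using piece_Nil by simp
    moreover have "\<forall>x. prefix x R \<and> piece Rel x \<longrightarrow> length x < Suc (length R)"
      by (simp add: prefix_length_le le_imp_less_Suc)
    ultimately show thesis
      using ex_has_greatest_nat[of "\<lambda>x. prefix x R \<and> piece Rel x" "[]" length "Suc (length R)"] that
      unfolding max_piece_prefix_def by metis
  qed
  obtain Z where Z: "max_piece_suffix Rel Z R"
  proof -
    have "suffix [] R \<and> piece Rel []" using piece_Nil by simp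
    moreover have "\<forall>x. suffix x R \<and> piece Rel x \<longrightarrow> length x < Suc (length R)"
      by (simp add: suffix_length_le le_imp_less_Suc)
    ultimately show thesis
      using ex_has_greatest_nat[of "\<lambda>x. suffix x R \<and> piece Rel x" "[]" length "Suc (length R)"] that
      unfolding max_piece_suffix_def by metis
  qed
  from X Z obtain a b where ab: "R = X @ a" "R = b @ Z" "piece Rel X" "piece Rel Z"
    unfolding max_piece_prefix_def max_piece_suffix_def prefix_def suffix_def by blast
  then have "b @ Z = X @ a" by simp
  then consider c where "b = X @ c" "a = c @ Z" | c where "X = b @ c" "Z = c @ a"
    by (elim append_eq_appendE) auto
  then show thesis
  proof cases
    case 1
    then show thesis using that[of X c Z] ab X Z R by (simp add: relation_factors_def)
  next
    case 2
    \<comment> \<open>If the two maximal pieces overlapped, \<open>R\<close> would be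
      \<open>X\<close> followed by a factor \<open>a\<close> of \<open>Z\<close>, a product of two
      pieces.\<close>
    then have "piece Rel a" using ab piece_sublist by blast
    then show thesis using not_two_pieces ab R by metis
  qed
qed

section \<open>Relation words meeting a middle word\<close>

definition factored_relation ::
    "'a list \<Rightarrow> 'a list \<Rightarrow> 'a list \<Rightarrow> 'a list \<Rightarrow> 'a list \<Rightarrow> 'a list \<Rightarrow> bool" where
  "factored_relation X Y Z Xb Yb Zb \<longleftrightarrow> relation_factors Rel X Y Z \<and> relation_factors Rel Xb Yb Zb \<and>
     opposite_sides Rel (X @ Y @ Z) (Xb @ Yb @ Zb)"

lemma factored_relation_sym:
  "factored_relation X Y Z Xb Yb Zb \<Longrightarrow> factored_relation Xb Yb Zb X Y Z"
  by (auto simp: factored_relation_def opposite_sides_sym)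

lemma factored_relation_exists:
  assumes "relation_factors Rel X Y Z"
  obtains Xb Yb Zb where "factored_relation X Y Z Xb Yb Zb"
proof -
  obtain S where S: "opposite_sides Rel (X @ Y @ Z) S"
    using relation_factors_word[OF assms] unfolding relation_words_def opposite_sides_def by fastforce
  then have "S \<in> relation_words Rel"
    using opposite_sides_sym opposite_sides_relation_words by blast
  then obtain Xb Yb Zb where "relation_factors Rel Xb Yb Zb" "S = Xb @ Yb @ Zb"
    using relation_factors_exist by blast
  then show thesis using that assms S by (auto simp: factored_relation_def)
qed

lemma factored_relation_eqv:
  "factored_relation X Y Z Xb Yb Zb \<Longrightarrow> X @ Y @ Z @ w \<approx> Xb @ Yb @ Zb @ w"
  using rewrite_step_opposite[of Rel "X @ Y @ Z" "Xb @ Yb @ Zb" "[]" w]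
  by (auto simp: factored_relation_def)

text \<open>The cases follow the place where \<open>R\<close> starts. Starting in \<open>q\<close>,
  it either covers \<open>Y\<close>, whose unique position forces \<open>R\<close> to be the whole
  word, or it would end early inside \<open>X @ Y @ Z\<close>, a second position for
  \<open>R\<close>. Starting inside \<open>Y\<close>, it must reach beyond \<open>Y\<close>.\<close>

lemma relation_word_overlap:
  assumes f: "relation_factors Rel X Y Z" and "suffix q X"
    and eq: "q @ Y @ s = a @ R @ b" and R: "R \<in> relation_words Rel"
  obtains (inside) a' where "a = q @ Y @ a'" "s = a' @ R @ b"
  | (whole) "a = []" "q = X" "R = X @ Y @ Z" "s = Z @ b"
  | (partial) Y' t r X1 Y1 Z1 where "Y = Y' @ t" "Y' \<noteq> []" "t \<noteq> []" "a = q @ Y'"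
      "relation_factors Rel X1 Y1 Z1" "X1 = t @ r" "R = X1 @ Y1 @ Z1" "s = r @ Y1 @ Z1 @ b"
proof -
  from \<open>suffix q X\<close> obtain q0 where q0: "X = q0 @ q" by (auto simp: suffix_def)
  note W = relation_factors_word[OF f]
  note np = relation_word_not_piece[OF R]
  consider a' where "a = q @ Y @ a'" "s = a' @ R @ b"
    | q' where "q = a @ q'" "q' @ Y @ s = R @ b"
    | Y' t where "Y = Y' @ t" "Y' \<noteq> []" "t \<noteq> []" "a = q @ Y'" "t @ s = R @ b"
    using eq
  proof (rule append_eq_appendE)
    fix e assume "a = q @ e" "Y @ s = e @ R @ b" "e \<noteq> []"
    note e = this
    from e(2) show thesis
    proof (rule append_eq_appendE)
      fix t assume "Y = e @ t" "R @ b = t @ s"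
      then show thesis using that(1)[of "[]"] that(3)[of e t] e by (cases "t = []") auto
    next
      fix f assume "e = Y @ f" "s = f @ R @ b"
      then show thesis using that(1)[of f] e by simp
    qed
  next
    fix e assume "q = a @ e" "R @ b = e @ Y @ s"
    then show thesis using that(2) by simp
  qed
  then show thesis
  proof cases
    case 1
    then show thesis by (rule inside)
  next
    case (2 q')
    then have "R @ b = (q' @ Y) @ s" by simp
    then consider m where "R = q' @ Y @ m" "s = m @ b" | d where "q' @ Y = R @ d" "d \<noteq> []"
      by (elim append_eq_appendE) auto
    then show thesis
    proof cases
      case (1 m)
      \<comment> \<open>\<open>Y\<close> is no piece, so its position in \<open>R\<close> is the one
        in \<open>X @ Y @ Z\<close>. As \<open>q'\<close> is a suffix of \<open>X\<close>, both
        \<open>q0\<close> and \<open>a\<close> are empty.\<close>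
      then have "q' = X \<and> m = Z"
        using nonpiece_occurrence[OF middle_not_piece[OF f], of q' m X Z] R W by simp
      then show thesis using whole 1 2 q0 by simp
    next
      case (2 d)
      then have "(q0 @ a) @ R @ (d @ Z) \<in> relation_words Rel"
        using W q0 \<open>q = a @ q'\<close> 2(1) by (metis append.assoc)
      then show thesis
        using nonpiece_occurrence[OF np, of "q0 @ a" "d @ Z" "[]" "[]"] R 2 by simp
    qed
  next
    case (3 Y' t)
    then consider m where "R = t @ m" "s = m @ b" | d where "t = R @ d"
      by (elim append_eq_appendE) auto
    then show thesis
    proof cases
      case (1 m)
      \<comment> \<open>\<open>t\<close> starts \<open>R\<close> but follows the non-empty
        \<open>X @ Y'\<close> in \<open>X @ Y @ Z\<close>; being a piece, it fits into
        \<open>X1\<close>.\<close>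
      have "piece Rel t"
        using nonpiece_occurrence[of Rel t "X @ Y'" Z "[]" m] R W 1 3 by auto
      moreover obtain X1 Y1 Z1 where "relation_factors Rel X1 Y1 Z1" "R = X1 @ Y1 @ Z1"
        using relation_factors_exist[OF R] .
      ultimately show thesis
        using piece_prefix_le[of X1 Y1 Z1 t m] 1 3 partial by (metis append.assoc)
    next
      case (2 d)
      then show thesis
        using nonpiece_occurrence[OF np, of "X @ Y'" "d @ Z" "[]" "[]"] R W 3 by simp
    qed
  qed
qed

section \<open>Derivations that keep a middle word\<close>

text \<open>Relates tails that can replace each other while one side of the relation stands before
  them. A derivation may change sides repeatedly, which is why the reflexive transitive closure
  appears first.\<close>

definition tail_step :: "'a list \<Rightarrow> 'a list \<Rightarrow> 'a list \<Rightarrow> 'a list \<Rightarrow> bool" where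
  "tail_step Z Zb w w' \<longleftrightarrow> Z @ w \<approx> Z @ w' \<or> Zb @ w \<approx> Zb @ w'"

lemma tail_step_commute: "tail_step Z Zb = tail_step Zb Z"
  by (auto simp: tail_step_def fun_eq_iff)

text \<open>Counting rewriting steps makes the induction possible: a relation word invading \<open>Y\<close> from
  the right lives in the tail \<open>s\<close>, which was reached from \<open>Z @ w1\<close> in fewer steps, so the
  statement applies to the reversed derivation of the tail.\<close>

lemma middle_protected_steps:
  assumes "factored_relation X Y Z Xb Yb Zb" "suffix q X"
    "(rewrite_step Rel ^^ n) (q @ Y @ Z @ w0) w"
  shows "(\<exists>s w1 k. w = q @ Y @ s \<and> (tail_step Z Zb)\<^sup>*\<^sup>* w0 w1 \<and> k \<le> n \<and>
            (rewrite_step Rel ^^ k) (Z @ w1) s) \<or>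
         (q = X \<and> (\<exists>s w1 k. w = Xb @ Yb @ s \<and> (tail_step Z Zb)\<^sup>*\<^sup>* w0 w1 \<and> k \<le> n \<and>
            (rewrite_step Rel ^^ k) (Zb @ w1) s))"
  using assms
proof (induction n arbitrary: X Y Z Xb Yb Zb q w0 w rule: less_induct)
  case (less n)
  \<comment> \<open>One further step; the factors are quantified afresh because the claim is applied
    to both sides of the relation.\<close>
  have next_tail: "(\<exists>s' k'. w = q @ Y @ s' \<and> k' \<le> n \<and> (rewrite_step Rel ^^ k') (Z @ w1) s') \<or>
      (q = X \<and> (\<exists>w2. Z @ w1 \<approx> Z @ w2 \<and> w = Xb @ Yb @ Zb @ w2))"
    if fr: "factored_relation X Y Z Xb Yb Zb" and q: "suffix q X" and w': "w' = q @ Y @ s"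
      and st: "rewrite_step Rel w' w"
      and k: "k < n" "(rewrite_step Rel ^^ k) (Z @ w1) s"
    for X Y Z Xb Yb Zb q w' s w1 k
  proof -
    have f: "relation_factors Rel X Y Z" using fr by (simp add: factored_relation_def)
    from st obtain a R R' b where o: "opposite_sides Rel R R'" and ab: "w' = a @ R @ b" "w = a @ R' @ b"
      unfolding rewrite_step_def by blast
    have R: "R \<in> relation_words Rel" using o by (rule opposite_sides_relation_words)
    from ab w' have "q @ Y @ s = a @ R @ b" by simp
    from f q this R show ?thesis
    proof (cases rule: relation_word_overlap)
      case (inside a')
      have "rewrite_step Rel s (a' @ R' @ b)" using inside rewrite_step_opposite[OF o] by simp
      then have "(rewrite_step Rel ^^ Suc k) (Z @ w1) (a' @ R' @ b)"
        using k(2) by (meson relpowp_Suc_I)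
      then show ?thesis using inside ab k(1) by (metis append.assoc Suc_leI)
    next
      case whole
      then have "R' = Xb @ Yb @ Zb"
        using fr o opposite_sides_unique by (simp add: factored_relation_def)
      moreover have "Z @ w1 \<approx> Z @ b" using k(2) whole relpowp_imp_rtranclp by metis
      ultimately show ?thesis using whole ab by auto
    next
      case (partial Y' t r X1 Y1 Z1)
      obtain X2 Y2 Z2 where fr1: "factored_relation X1 Y1 Z1 X2 Y2 Z2"
        using factored_relation_exists[OF partial(5)] .
      \<comment> \<open>The reversed tail derivation starts from \<open>r @ Y1 @ Z1 @ b\<close> with
        \<open>r\<close> a proper suffix of \<open>X1\<close>, so the induction hypothesis leaves
        \<open>r @ Y1\<close> at the front of \<open>Z @ w1\<close>.\<close>
      have "(rewrite_step Rel ^^ k) (r @ Y1 @ Z1 @ b) (Z @ w1)"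
        using rewrite_steps_sym[OF k(2)] partial by simp
      moreover have "suffix r X1" "r \<noteq> X1" using partial by (auto simp: suffix_def)
      ultimately obtain s' where "Z @ w1 = r @ Y1 @ s'"
        using less.IH[OF k(1) fr1] by blast
      then have "(t @ Z) @ w1 = (X1 @ Y1) @ s'" using partial by simp
      \<comment> \<open>Either way a non-piece, \<open>X1 @ Y1\<close> or \<open>t @ Z\<close>,
        starts \<open>X1 @ Y1 @ Z1\<close> and follows the non-empty \<open>X @ Y'\<close> in
        \<open>X @ Y @ Z\<close>.\<close>
      then consider d where "t @ Z = (X1 @ Y1) @ d" | d where "X1 @ Y1 = (t @ Z) @ d"
        by (elim append_eq_appendE) auto
      then show ?thesis
      proof cases
        case (1 d)
        then show ?thesis
          using nonpiece_occurrence[OF prefix_middle_not_piece[OF partial(5)], of "X @ Y'" d "[]" Z1]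
            relation_factors_word[OF f] relation_factors_word[OF partial(5)] partial by simp
      next
        case (2 d)
        then show ?thesis
          using nonpiece_occurrence[OF suffix_extension_not_piece[OF f partial(1,3)], of "X @ Y'" "[]" "[]" "d @ Z1"]
            relation_factors_word[OF f] relation_factors_word[OF partial(5)] partial
          by (simp flip: append_assoc)
      qed
    qed
  qed
  show ?case
  proof (cases n)
    case 0
    then show ?thesis using less.prems by force
  next
    case (Suc m)
    then obtain w' where m: "(rewrite_step Rel ^^ m) (q @ Y @ Z @ w0) w'" and st: "rewrite_step Rel w' w"
      using less.prems(3) by auto
    have "m < n" using Suc by simp
    from less.IH[OF this less.prems(1,2) m] consider
      (same) s w1 k where "w' = q @ Y @ s" "(tail_step Z Zb)\<^sup>*\<^sup>* w0 w1" "k \<le> m"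
        "(rewrite_step Rel ^^ k) (Z @ w1) s"
    | (other) s w1 k where "q = X" "w' = Xb @ Yb @ s" "(tail_step Z Zb)\<^sup>*\<^sup>* w0 w1" "k \<le> m"
        "(rewrite_step Rel ^^ k) (Zb @ w1) s" by blast
    then show ?thesis
    proof cases
      case same
      have "k < n" using same Suc by simp
      from next_tail[OF less.prems(1,2) same(1) st this same(4)] show ?thesis
      proof
        assume "q = X \<and> (\<exists>w2. Z @ w1 \<approx> Z @ w2 \<and> w = Xb @ Yb @ Zb @ w2)"
        then obtain w2 where w2: "q = X" "tail_step Z Zb w1 w2" "w = Xb @ Yb @ Zb @ w2"
          by (auto simp: tail_step_def)
        then have "(tail_step Z Zb)\<^sup>*\<^sup>* w0 w2" using same(2) by auto
        \<comment> \<open>After an exchange of sides the tail derivation restarts with length 0 from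
          \<open>w2\<close>; what happened before it is absorbed in a tail step.\<close>
        moreover have "(rewrite_step Rel ^^ 0) (Zb @ w2) (Zb @ w2)" by simp
        ultimately show ?thesis using w2 by blast
      qed (use same(2) in blast)
    next
      case other
      have "k < n" using other Suc by simp
      from next_tail[OF factored_relation_sym[OF less.prems(1)] suffix_order.order_refl other(2) st this other(5)]
      show ?thesis
      proof
        assume "Xb = Xb \<and> (\<exists>w2. Zb @ w1 \<approx> Zb @ w2 \<and> w = X @ Y @ Z @ w2)"
        then obtain w2 where w2: "tail_step Z Zb w1 w2" "w = X @ Y @ Z @ w2"
          by (auto simp: tail_step_def)
        then have "(tail_step Z Zb)\<^sup>*\<^sup>* w0 w2" using other(3) by auto
        moreover have "(rewrite_step Rel ^^ 0) (Z @ w2) (Z @ w2)" by simp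
        ultimately show ?thesis using w2 other(1) by blast
      qed (use other(1,3) in blast)
    qed
  qed
qed

lemma middle_protected_whole:
  assumes "factored_relation X Y Z Xb Yb Zb" "X @ Y @ Z @ w0 \<approx> w"
  obtains s w1 where "w = X @ Y @ s" "(tail_step Z Zb)\<^sup>*\<^sup>* w0 w1" "Z @ w1 \<approx> s"
  | s w1 where "w = Xb @ Yb @ s" "(tail_step Z Zb)\<^sup>*\<^sup>* w0 w1" "Zb @ w1 \<approx> s"
proof -
  from assms(2) obtain n where "(rewrite_step Rel ^^ n) (X @ Y @ Z @ w0) w"
    using rtranclp_imp_relpowp by metis
  from middle_protected_steps[OF assms(1) suffix_order.order_refl this] that relpowp_imp_rtranclp
  show thesis by metis
qed

text \<open>With a non-empty part \<open>t\<close> of \<open>X\<close> missing, the whole relation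
  word is never available, so the alternative of changing sides disappears.\<close>

lemma middle_protected_proper:
  assumes "relation_factors Rel X Y Z" "X = t @ q" "t \<noteq> []" "q @ Y @ Z @ w0 \<approx> w"
  obtains s where "w = q @ Y @ s"
proof -
  obtain Xb Yb Zb where fr: "factored_relation X Y Z Xb Yb Zb"
    using factored_relation_exists[OF assms(1)] .
  from assms(4) obtain n where "(rewrite_step Rel ^^ n) (q @ Y @ Z @ w0) w"
    using rtranclp_imp_relpowp by metis
  moreover have "suffix q X" "q \<noteq> X" using assms by (auto simp: suffix_def)
  ultimately show thesis using middle_protected_steps[OF fr] that by blast
qed

section \<open>Cancelling pieces on the left\<close>

text \<open>The first step that touches \<open>P\<close> uses a relation word starting inside
  \<open>P\<close>; its overlap \<open>p\<close> is a piece, hence lies in the maximal piece prefix.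
  From then on the word after \<open>P'\<close> starts with the \<open>XY\<close> part of one of the
  two sides, which keeps later relation words out of \<open>P'\<close>.\<close>

lemma piece_cancel:
  assumes "piece Rel P" "P @ w0 \<approx> g"
  shows "(\<exists>g'. g = P @ g' \<and> w0 \<approx> g') \<or>
    (\<exists>P' p r X Y Z w' g'. P = P' @ p \<and> p \<noteq> [] \<and> relation_factors Rel X Y Z \<and> X = p @ r \<and>
       w0 \<approx> r @ Y @ Z @ w' \<and> g = P' @ g' \<and> X @ Y @ Z @ w' \<approx> g')"
  using assms(2)
proof (induction rule: rtranclp_induct)
  case (step g h)
  from step.hyps(2) obtain a R R' b where o: "opposite_sides Rel R R'"
    and ab: "g = a @ R @ b" "h = a @ R' @ b"
    unfolding rewrite_step_def by blast
  have R: "R \<in> relation_words Rel" using o by (rule opposite_sides_relation_words)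
  have sub: "piece Rel x" if "P = c @ x @ d" for c x d
    using assms(1) piece_sublist that by (metis sublist_appendI)
  have inner: "g' \<approx> a' @ R' @ b" if "g' = a' @ R @ b" for g' a'
    using rewrite_step_opposite[OF o] that by blast
  from step.IH show ?case
  proof (elim disjE exE conjE)
    fix g' assume g': "g = P @ g'" "w0 \<approx> g'"
    then consider a' where "a = P @ a'" "g' = a' @ R @ b"
      | p where "P = a @ p" "p \<noteq> []" "p @ g' = R @ b"
      using ab by (metis append_eq_appendE)
    then show ?case
    proof cases
      case (1 a')
      then show ?thesis using g'(2) inner ab by (metis append.assoc rtranclp_trans)
    next
      case (2 p)
      then consider m where "R = p @ m" "g' = m @ b" | d where "p = R @ d"
        by (elim append_eq_appendE) auto
      then show ?thesis
      proof cases
        case (1 m)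
        obtain X Y Z where f: "relation_factors Rel X Y Z" and RX: "R = X @ Y @ Z"
          using relation_factors_exist[OF R] .
        have "piece Rel p" using sub[of a p "[]"] 2 by simp
        then obtain r where r: "X = p @ r" "m = r @ Y @ Z"
          using piece_prefix_le[OF f] 1 RX by metis
        have "w0 \<approx> r @ Y @ Z @ b" using g' 1 r by simp
        moreover have "X @ Y @ Z @ b \<approx> R' @ b"
          using inner[of "R @ b" "[]"] RX by simp
        ultimately show ?thesis using 2 f r(1) ab(2) by blast
      next
        case (2 d)
        then show ?thesis using sub[of a R d] \<open>P = a @ p\<close> relation_word_not_piece[OF R] by simp
      qed
    qed
  next
    fix P' p r X Y Z w' g'
    assume P': "P = P' @ p" "p \<noteq> []" "relation_factors Rel X Y Z" "X = p @ r"
      "w0 \<approx> r @ Y @ Z @ w'" "g = P' @ g'" "X @ Y @ Z @ w' \<approx> g'"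
    then consider a' where "a = P' @ a'" "g' = a' @ R @ b"
      | t where "P' = a @ t" "t \<noteq> []" "t @ g' = R @ b"
      using ab by (metis append_eq_appendE)
    then show ?case
    proof cases
      case (1 a')
      then have "X @ Y @ Z @ w' \<approx> a' @ R' @ b" using P'(7) inner by (meson rtranclp_trans)
      moreover have "h = P' @ a' @ R' @ b" using ab 1 by simp
      ultimately show ?thesis using P' by blast
    next
      case (2 t)
      obtain Xb Yb Zb where fr: "factored_relation X Y Z Xb Yb Zb"
        using factored_relation_exists[OF P'(3)] .
      from middle_protected_whole[OF fr P'(7)] obtain X2 Y2 Z2 s
        where f2: "relation_factors Rel X2 Y2 Z2" and g': "g' = X2 @ Y2 @ s"
        using fr unfolding factored_relation_def by metis
      note W2 = relation_factors_word[OF f2]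
      have t: "piece Rel t" using sub[of a t p] 2 P'(1) by simp
      from 2 g' have "t @ (X2 @ Y2) @ s = R @ b" by simp
      \<comment> \<open>A relation word starting in \<open>P'\<close> could cover
        \<open>X2 @ Y2\<close>, end inside it, or end inside \<open>t\<close>.\<close>
      then consider m where "R = t @ (X2 @ Y2) @ m" | m d where "R = t @ m" "X2 @ Y2 = m @ d"
        | d where "t = R @ d"
        by (elim append_eq_appendE) auto
      then show ?thesis
      proof cases
        case (1 m)
        then show ?thesis
          using nonpiece_occurrence[OF prefix_middle_not_piece[OF f2], of t m "[]" Z2] R W2 2 by simp
      next
        case (2 m d)
        have "X2 @ Y2 @ Z2 = m @ d @ Z2" using 2(2) by (metis append.assoc)
        then have "[] @ m @ d @ Z2 \<in> relation_words Rel" "t @ m @ [] \<in> relation_words Rel"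
          using R W2 2(1) \<open>X2 @ Y2 @ Z2 = m @ d @ Z2\<close> by auto
        \<comment> \<open>\<open>m\<close> starts \<open>X2 @ Y2 @ Z2\<close> but follows the
          non-empty \<open>t\<close> in \<open>R\<close>, so \<open>R\<close> is a product of two
          pieces.\<close>
        then have "piece Rel m"
          using nonpiece_occurrence[of Rel m t "[]" "[]" "d @ Z2"] \<open>t \<noteq> []\<close> by blast
        then show ?thesis using not_two_pieces t R 2(1) by blast
      next
        case (3 d)
        then have "piece Rel R" using t piece_sublist by blast
        then show ?thesis using relation_word_not_piece[OF R] by simp
      qed
    qed
  qed
qed auto

text \<open>If both pieces are touched, the two relation words involved compete for the front of the
  same \<open>w\<close>. Uniqueness of middle words makes them absorb the same suffix
  \<open>p\<close> of \<open>P\<close> and \<open>Q\<close>.\<close>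

lemma piece_cancel2:
  assumes "piece Rel P" "piece Rel Q" "P @ w \<approx> g" "Q @ w \<approx> h"
  obtains g' where "g = P @ g'" "w \<approx> g'"
  | h' where "h = Q @ h'" "w \<approx> h'"
  | P' Q' p g' h' where "P = P' @ p" "Q = Q' @ p" "p \<noteq> []" "g = P' @ g'" "h = Q' @ h'"
      "p @ w \<approx> g'" "p @ w \<approx> h'"
proof -
  from piece_cancel[OF assms(1,3)] piece_cancel[OF assms(2,4)]
  consider g' where "g = P @ g'" "w \<approx> g'" | h' where "h = Q @ h'" "w \<approx> h'"
    | P' p r X Y Z w' g' Q' p2 r2 X2 Y2 Z2 w2 h'
    where "P = P' @ p" "p \<noteq> []" "relation_factors Rel X Y Z" "X = p @ r"
       "w \<approx> r @ Y @ Z @ w'" "g = P' @ g'" "X @ Y @ Z @ w' \<approx> g'"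
       "Q = Q' @ p2" "p2 \<noteq> []" "relation_factors Rel X2 Y2 Z2" "X2 = p2 @ r2"
       "w \<approx> r2 @ Y2 @ Z2 @ w2" "h = Q' @ h'" "X2 @ Y2 @ Z2 @ w2 \<approx> h'"
    by blast
  then show thesis
  proof cases
    case 3
    have "r @ Y @ Z @ w' \<approx> r2 @ Y2 @ Z2 @ w2"
      using 3(5,12) rewrite_eq_sym rtranclp_trans by metis
    then obtain s where s: "r2 @ Y2 @ Z2 @ w2 = r @ Y @ s"
      using middle_protected_proper[OF 3(3,4,2)] by blast
    then have "(r2 @ Y2) @ Z2 @ w2 = (r @ Y) @ s" by simp
    then consider d where "r2 @ Y2 = r @ Y @ d" | d where "r @ Y = r2 @ Y2 @ d"
      by (elim append_eq_appendE) auto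
    then have "p = p2"
    proof cases
      case (1 d)
      \<comment> \<open>This displays \<open>Y\<close> inside \<open>X2 @ Y2 @ Z2\<close>; its
        unique position gives \<open>p2 @ r = X = p @ r\<close>.\<close>
      then have "(p2 @ r) @ Y @ (d @ Z2) = X2 @ Y2 @ Z2" using 3(11)
        by (metis append.assoc)
      then show ?thesis
        using nonpiece_occurrence[OF middle_not_piece[OF 3(3)], of "p2 @ r" "d @ Z2" X Z]
          relation_factors_word[OF 3(3)] relation_factors_word[OF 3(10)] 3(4) by (metis append_same_eq)
    next
      case (2 d)
      then have "(p @ r2) @ Y2 @ (d @ Z) = X @ Y @ Z" using 3(4)
        by (metis append.assoc)
      then show ?thesis
        using nonpiece_occurrence[OF middle_not_piece[OF 3(10)], of "p @ r2" "d @ Z" X2 Z2]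
          relation_factors_word[OF 3(3)] relation_factors_word[OF 3(10)] 3(11) by (metis append_same_eq)
    qed
    moreover have "p @ w \<approx> g'"
      using rewrite_eq_append_left[OF 3(5), of p] 3(4,7) by (auto intro: rtranclp_trans)
    moreover have "p2 @ w \<approx> h'"
      using rewrite_eq_append_left[OF 3(12), of p2] 3(11,14) by (auto intro: rtranclp_trans)
    ultimately show thesis using that(3) 3 by metis
  qed (use that in blast)+
qed

section \<open>Collapsing chains of tail steps\<close>

text \<open>Only the mixed case needs an idea. Seen from \<open>b\<close>, either one piece cancels
  and its equality can be moved behind the other piece, or both equalities already hold behind a
  common suffix \<open>p\<close>.\<close>

lemma tail_step_trans:
  assumes "piece Rel Z" "piece Rel Zb" "tail_step Z Zb a b" "tail_step Z Zb b c"
  shows "tail_step Z Zb a c"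
proof -
  have mixed: "tail_step P Q a c"
    if "piece Rel P" "piece Rel Q" "P @ a \<approx> P @ b" "Q @ b \<approx> Q @ c" for P Q
    using that(1,2) rewrite_eq_sym[OF that(3)] that(4)
  proof (cases rule: piece_cancel2)
    case (1 g')
    then have "Q @ a \<approx> Q @ b" using rewrite_eq_append_left rewrite_eq_sym by blast
    then show ?thesis using that(4) by (auto simp: tail_step_def intro: rtranclp_trans)
  next
    case (2 h')
    then have "P @ b \<approx> P @ c" using rewrite_eq_append_left by blast
    then show ?thesis using that(3) by (auto simp: tail_step_def intro: rtranclp_trans)
  next
    case (3 P' Q' p g' h')
    then have "p @ a \<approx> p @ c" using rewrite_eq_sym by (auto intro: rtranclp_trans)
    then show ?thesis
      using 3(1) rewrite_eq_append_left[of Rel "p @ a" "p @ c" P'] by (simp add: tail_step_def)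
  qed
  from assms(3,4) consider "Z @ a \<approx> Z @ b" "Z @ b \<approx> Z @ c" | "Zb @ a \<approx> Zb @ b" "Zb @ b \<approx> Zb @ c"
    | "Z @ a \<approx> Z @ b" "Zb @ b \<approx> Zb @ c" | "Zb @ a \<approx> Zb @ b" "Z @ b \<approx> Z @ c"
    unfolding tail_step_def by blast
  then show ?thesis
  proof cases
    case 3
    then show ?thesis using mixed assms(1,2) by blast
  next
    case 4
    then show ?thesis using mixed assms(1,2) tail_step_commute by metis
  qed (auto simp: tail_step_def intro: rtranclp_trans)
qed

lemma tail_steps_collapse:
  assumes "piece Rel Z" "piece Rel Zb" "(tail_step Z Zb)\<^sup>*\<^sup>* a b"
  shows "tail_step Z Zb a b"
  using assms(3)
proof (induction rule: rtranclp_induct)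
  case base
  then show ?case by (simp add: tail_step_def)
next
  case (step b c)
  then show ?case using tail_step_trans[OF assms(1,2)] by blast
qed

section \<open>Derivations from a clean prefix\<close>

text \<open>The second alternative starts with the first use of \<open>X @ Y @ Z\<close>; from there
  on \<open>middle_protected_whole\<close> can take over. Before that, cleanness keeps relation
  words out of \<open>Y\<close>.\<close>

lemma clean_prefix_rewrites:
  assumes fr: "factored_relation X Y Z Xb Yb Zb" and cl: "clean Rel [] X Y (X @ Y @ u')"
    and "X @ Y @ u' \<approx> v"
  shows "(\<exists>v'. v = X @ Y @ v' \<and> u' \<approx> v') \<or> (\<exists>w. u' \<approx> Z @ w \<and> X @ Y @ Z @ w \<approx> v)"
  using assms(3)
proof (induction rule: rtranclp_induct)
  case (step v v2)
  have f: "relation_factors Rel X Y Z" using fr by (simp add: factored_relation_def)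
  from step.IH show ?case
  proof (elim disjE exE conjE)
    fix v' assume v': "v = X @ Y @ v'" "u' \<approx> v'"
    from step.hyps(2) obtain a R R' b where o: "opposite_sides Rel R R'"
      and ab: "v = a @ R @ b" "v2 = a @ R' @ b"
      unfolding rewrite_step_def by blast
    have R: "R \<in> relation_words Rel" using o by (rule opposite_sides_relation_words)
    have "X @ Y @ v' = a @ R @ b" using ab v' by simp
    from f suffix_order.order_refl this R show ?case
    proof (cases rule: relation_word_overlap)
      case (inside a')
      then have "u' \<approx> a' @ R' @ b"
        using rewrite_step_opposite[OF o] v'(2) by (metis rtranclp.rtrancl_into_rtrancl)
      then show ?thesis using inside ab by auto
    next
      case whole
      moreover have "X @ Y @ Z @ b \<approx> v2" using step.hyps(2) whole ab by auto
      ultimately show ?thesis using v' by blast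
    next
      case (partial Y' t r X1 Y1 Z1)
      \<comment> \<open>Tracing the tail back to \<open>u'\<close> shows that an invading
        \<open>X1 @ Y1\<close> is already visible in the initial word.\<close>
      have "r @ Y1 @ Z1 @ b \<approx> u'" using v'(2) partial rewrite_eq_sym by metis
      then obtain s where "u' = r @ Y1 @ s"
        using middle_protected_proper[OF partial(5,6,3)] by blast
      then have "X @ Y @ u' = (X @ Y' @ X1 @ Y1) @ s" using partial by simp
      moreover have "strict_prefix Y' Y" using partial by (simp add: strict_prefix_def)
      ultimately have "\<not> clean Rel [] X Y (X @ Y @ u')"
        using partial(2,5) unfolding clean_def prefix_def by (metis append_Nil)
      then show ?thesis using cl by simp
    qed
  next
    fix w assume "u' \<approx> Z @ w" "X @ Y @ Z @ w \<approx> v"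
    then show ?case using step.hyps(2) by (meson rtranclp.rtrancl_into_rtrancl)
  qed
qed auto

text \<open>This is the source of condition (6): neither piece survives as a prefix, so both are
  touched, and only within a common suffix.\<close>

lemma common_suffix_split:
  assumes "piece Rel Z" "piece Rel Zb" "Z @ w \<approx> u'" "Zb @ w \<approx> s" "\<not> prefix Z u'" "\<not> prefix Zb s"
  obtains z1 z2 z g h where "Z = z1 @ z" "Zb = z2 @ z" "u' = z1 @ g" "s = z2 @ h"
    "g \<approx> h" "max_common_suffix z Z Zb" "z \<noteq> []" "z @ w \<approx> g"
proof -
  have "suffix [] Z \<and> suffix [] Zb" by simp
  moreover have "\<forall>x. suffix x Z \<and> suffix x Zb \<longrightarrow> length x < Suc (length Z)"
    by (simp add: suffix_length_le le_imp_less_Suc)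
  ultimately obtain z where z: "max_common_suffix z Z Zb"
    unfolding max_common_suffix_def
    using ex_has_greatest_nat[of "\<lambda>x. suffix x Z \<and> suffix x Zb" "[]" length "Suc (length Z)"] by metis
  from assms(1-4) show thesis
  proof (cases rule: piece_cancel2)
    case (3 P' Q' p g' h')
    have zz: "suffix z Z" "suffix z Zb" "length p \<le> length z"
      using z 3(1,2) unfolding max_common_suffix_def by (auto simp: suffix_def)
    then have "suffix p z" using 3(1) by (metis suffix_length_suffix suffixI)
    then obtain z' where z': "z = z' @ p" by (auto simp: suffix_def)
    obtain z1 where z1: "Z = z1 @ z" using zz(1) by (auto simp: suffix_def)
    obtain z2 where z2: "Zb = z2 @ z" using zz(2) by (auto simp: suffix_def)
    \<comment> \<open>The touched suffix \<open>p\<close> may be shorter than \<open>z\<close>; the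
      difference \<open>z'\<close> moves into the tails.\<close>
    have P: "P' = z1 @ z'" "Q' = z2 @ z'" using 3(1,2) z1 z2 z' by auto
    have g: "z @ w \<approx> z' @ g'" "z @ w \<approx> z' @ h'"
      using 3(6,7) z' rewrite_eq_append_left by fastforce+
    then have "z' @ g' \<approx> z' @ h'" using rewrite_eq_sym by (metis rtranclp_trans)
    then show thesis using that[of z1 z z2 "z' @ g'" "z' @ h'"] z1 z2 z z' 3 P g by auto
  qed (use assms(5,6) in auto)
qed

text \<open>As \<open>Z\<close> is not a prefix of \<open>u'\<close>, it cannot be cancelled. So
  \<open>w\<close> and \<open>w'\<close> agree outright or behind a suffix of \<open>Z\<close>, and
  the equality given behind \<open>Zb\<close> also holds behind \<open>Z\<close>.\<close>

lemma tail_transfer: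
  assumes "piece Rel Z" "piece Rel Zb" "Z @ w \<approx> u'" "\<not> prefix Z u'" "Zb @ w \<approx> Zb @ w'"
  shows "Z @ w' \<approx> u'"
proof -
  have "Z @ w \<approx> Z @ w'"
    using assms(1,2,3,5)
  proof (cases rule: piece_cancel2)
    case (2 h')
    then show ?thesis using rewrite_eq_append_left by blast
  next
    case (3 P' Q' p g' h')
    then have "p @ w \<approx> p @ w'" by simp
    then show ?thesis using 3(1) rewrite_eq_append_left[of Rel "p @ w" "p @ w'" P'] by simp
  qed (use assms(4) in auto)
  then show ?thesis using assms(3) rewrite_eq_sym by (metis rtranclp_trans)
qed

text \<open>Otherwise one of \<open>X @ Y\<close> and \<open>Xb @ Yb\<close> would be a factor of
  both sides of one relation, hence a piece. This separates conditions (1) and (2) from the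
  others.\<close>

lemma prefix_middle_incomparable:
  assumes fr: "factored_relation X Y Z Xb Yb Zb"
  shows "X @ Y @ s \<noteq> Xb @ Yb @ s'"
proof
  assume "X @ Y @ s = Xb @ Yb @ s'"
  then have "(X @ Y) @ s = (Xb @ Yb) @ s'" by simp
  then consider d where "X @ Y = (Xb @ Yb) @ d" | d where "Xb @ Yb = (X @ Y) @ d"
    by (elim append_eq_appendE) auto
  moreover have "False"
    if fr: "factored_relation X Y Z Xb Yb Zb" and eq: "X @ Y = (Xb @ Yb) @ d" for X Y Z Xb Yb Zb d
  proof -
    have "sublist (Xb @ Yb) (X @ Y @ Z)" "sublist (Xb @ Yb) (Xb @ Yb @ Zb)"
      using eq by (metis append.assoc sublist_append_rightI sublist_append_leftI)+
    then have "piece Rel (Xb @ Yb)"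
      using fr unfolding factored_relation_def opposite_sides_def piece_def
      by (metis fst_conv snd_conv)
    then show False using fr prefix_middle_not_piece by (auto simp: factored_relation_def)
  qed
  ultimately show False using fr factored_relation_sym by metis
qed

lemma rewrites_of_clean_prefix:
  assumes fr: "factored_relation X Y Z Xb Yb Zb" and cl: "clean Rel [] X Y (X @ Y @ u')"
    and uv: "X @ Y @ u' \<approx> v"
  shows "(\<exists>u'' v''. u' = Z @ u'' \<and> v = X @ Y @ Z @ v'' \<and> tail_step Z Zb u'' v'') \<or>
    (\<exists>v'. v = X @ Y @ v' \<and> (\<not> prefix Z u' \<or> \<not> prefix Z v') \<and> u' \<approx> v') \<or>
    (\<exists>u'' v''. u' = Z @ u'' \<and> v = Xb @ Yb @ Zb @ v'' \<and> tail_step Z Zb u'' v'') \<or>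
    (\<exists>v''. v = Xb @ Yb @ Zb @ v'' \<and> \<not> prefix Z u' \<and> u' \<approx> Z @ v'') \<or>
    (\<exists>u'' v'. u' = Z @ u'' \<and> v = Xb @ Yb @ v' \<and> \<not> prefix Zb v' \<and> Zb @ u'' \<approx> v') \<or>
    (\<exists>v' u'' v'' z1 z2 z w. v = Xb @ Yb @ v' \<and> \<not> prefix Z u' \<and> \<not> prefix Zb v' \<and>
       Z = z1 @ z \<and> Zb = z2 @ z \<and> u' = z1 @ u'' \<and> v' = z2 @ v'' \<and> u'' \<approx> v'' \<and>
       max_common_suffix z Z Zb \<and> z \<noteq> [] \<and> z @ w \<approx> u'')"
    (is "?c1 \<or> ?c2 \<or> ?c3 \<or> ?c4 \<or> ?c5 \<or> ?c6")
proof -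
  have Z: "piece Rel Z" "piece Rel Zb"
    using fr relation_factors_pieces by (auto simp: factored_relation_def)
  note tr = tail_step_trans[OF Z]
  have ext: "tail_step Z Zb u'' w" if "Z @ u'' \<approx> Z @ w" for u'' w
    using that by (simp add: tail_step_def)
  have extb: "tail_step Z Zb u'' w" if "Zb @ u'' \<approx> Zb @ w" for u'' w
    using that by (simp add: tail_step_def)
  have same_prefix: "?c1 \<or> ?c2" if "v = X @ Y @ v'" "u' \<approx> v'" for v'
  proof (cases "prefix Z u' \<and> prefix Z v'")
    case True
    then obtain u'' v'' where "u' = Z @ u''" "v' = Z @ v''" by (auto simp: prefix_def)
    then have ?c1 using that by (auto simp: tail_step_def)
    then show ?thesis ..
  next
    case False
    then show ?thesis using that by blast
  qed
  from clean_prefix_rewrites[OF fr cl uv] show ?thesis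
  proof (elim disjE exE conjE)
    fix v' assume "v = X @ Y @ v'" "u' \<approx> v'"
    then show ?thesis using same_prefix by blast
  next
    fix w assume w: "u' \<approx> Z @ w" "X @ Y @ Z @ w \<approx> v"
    from fr w(2) show ?thesis
    proof (cases rule: middle_protected_whole)
      case (1 s w1)
      have ww: "tail_step Z Zb w w1" using tail_steps_collapse[OF Z 1(2)] .
      show ?thesis
      proof (cases "prefix Z u' \<and> prefix Z s")
        case True
        then obtain u'' v'' where uv: "u' = Z @ u''" "s = Z @ v''" by (auto simp: prefix_def)
        then have "tail_step Z Zb u'' w" "tail_step Z Zb w1 v''" using ext w 1 by auto
        then have "tail_step Z Zb u'' v''" using tr ww by blast
        then have ?c1 using uv 1(1) by blast
        then show ?thesis ..
      next
        case False
        \<comment> \<open>If the tails \<open>w\<close> and \<open>w1\<close> agree only behind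
          \<open>Zb\<close>, the equality is transferred at whichever of \<open>u'\<close> and
          \<open>s\<close> does not start with \<open>Z\<close>.\<close>
        have "u' \<approx> s"
        proof (cases "Z @ w \<approx> Z @ w1")
          case True
          then show ?thesis using w(1) 1(3) by (meson rtranclp_trans)
        next
          case no: False
          then have b: "Zb @ w \<approx> Zb @ w1" using ww by (simp add: tail_step_def)
          from False show ?thesis
          proof (cases "prefix Z u'")
            case True
            then have "Z @ w \<approx> s"
              using tail_transfer[OF Z 1(3) _ rewrite_eq_sym[OF b]] False by blast
            then show ?thesis using w(1) by (meson rtranclp_trans)
          next
            case False
            then have "u' \<approx> Z @ w1"
              using rewrite_eq_sym[OF tail_transfer[OF Z rewrite_eq_sym[OF w(1)] False b]] by blast
            then show ?thesis using 1(3) by (meson rtranclp_trans)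
          qed
        qed
        then show ?thesis using same_prefix 1(1) by blast
      qed
    next
      case (2 s w1)
      have ww: "tail_step Z Zb w w1" using tail_steps_collapse[OF Z 2(2)] .
      \<comment> \<open>One tail serves both sides: \<open>w1\<close> if the tail step holds behind
        \<open>Z\<close>, and \<open>w\<close> if it holds behind \<open>Zb\<close>.\<close>
      obtain y where y: "Z @ y \<approx> u'" "Zb @ y \<approx> s"
      proof (cases "Z @ w \<approx> Z @ w1")
        case True
        then show thesis using that[of w1] 2(3) w(1) rewrite_eq_sym by (meson rtranclp_trans)
      next
        case False
        then have "Zb @ w \<approx> Zb @ w1" using ww by (simp add: tail_step_def)
        then show thesis using that[of w] 2(3) rewrite_eq_sym[OF w(1)] by (meson rtranclp_trans)
      qed
      show ?thesis
      proof (cases "prefix Z u'")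
        case True
        then obtain u'' where u: "u' = Z @ u''" by (auto simp: prefix_def)
        show ?thesis
        proof (cases "prefix Zb s")
          case True
          then obtain v'' where v: "s = Zb @ v''" by (auto simp: prefix_def)
          have "tail_step Z Zb u'' v''"
            using tr[OF ext extb] y u v rewrite_eq_sym by metis
          then have ?c3 using 2(1) u v by blast
          then show ?thesis by blast
        next
          case False
          \<comment> \<open>Transfer with the roles of \<open>Z\<close> and \<open>Zb\<close>
            exchanged.\<close>
          have "Zb @ u'' \<approx> s" using tail_transfer[OF Z(2,1) y(2) False] y(1) u by blast
          then have ?c5 using 2(1) u False by blast
          then show ?thesis by blast
        qed
      next
        case False
        show ?thesis
        proof (cases "prefix Zb s")
          case True
          then obtain v'' where v: "s = Zb @ v''" by (auto simp: prefix_def)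
          have "Z @ v'' \<approx> u'" using tail_transfer[OF Z y(1) False] y(2) v by blast
          then have ?c4 using 2(1) v False rewrite_eq_sym by blast
          then show ?thesis by blast
        next
          case no: False
          obtain z1 z2 z g h where "Z = z1 @ z" "Zb = z2 @ z" "u' = z1 @ g" "s = z2 @ h"
            "g \<approx> h" "max_common_suffix z Z Zb" "z \<noteq> []" "z @ y \<approx> g"
            using common_suffix_split[OF Z y False no] .
          then have ?c6 using 2(1) False no by blast
          then show ?thesis by blast
        qed
      qed
    qed
  qed
qed

section \<open>Converse direction\<close>

lemma eqv_via_opposite:
  assumes fr: "factored_relation X Y Z Xb Yb Zb" and "Z @ w \<approx> u'" "Zb @ w \<approx> v'"
  shows "X @ Y @ u' \<approx> Xb @ Yb @ v'"
proof -
  have "X @ Y @ u' \<approx> X @ Y @ Z @ w"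
    using rewrite_eq_append_left[OF rewrite_eq_sym[OF assms(2)], of "X @ Y"] by simp
  moreover have "Xb @ Yb @ Zb @ w \<approx> Xb @ Yb @ v'"
    using rewrite_eq_append_left[OF assms(3), of "Xb @ Yb"] by simp
  ultimately show ?thesis using factored_relation_eqv[OF fr, of w] by (meson rtranclp_trans)
qed

text \<open>The piece witnessing the tail step decides whether the relation is applied in front of
  \<open>w\<close> or of \<open>w'\<close>. Going to the other side and back gives the first
  claim.\<close>

lemma eqv_of_tail_step:
  assumes fr: "factored_relation X Y Z Xb Yb Zb" and "tail_step Z Zb w w'"
  shows "X @ Y @ Z @ w \<approx> X @ Y @ Z @ w'" "X @ Y @ Z @ w \<approx> Xb @ Yb @ Zb @ w'"
proof -
  show "X @ Y @ Z @ w \<approx> Xb @ Yb @ Zb @ w'"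
    using assms(2) eqv_via_opposite[OF fr] rewrite_eq_sym rtranclp.rtrancl_refl
    unfolding tail_step_def by metis
  then show "X @ Y @ Z @ w \<approx> X @ Y @ Z @ w'"
    using rewrite_eq_sym[OF factored_relation_eqv[OF fr, of w']] by (meson rtranclp_trans)
qed

end

section \<open>Assembling the six conditions\<close>

theorem lemma3:
  fixes A :: "'a set" and Rel :: "('a list \<times> 'a list) set"
    and X Y Z Xb Yb Zb u u' v :: "'a list"
  assumes "finite_presentation A Rel"
    and "small_overlap 4 Rel"
    and "relation_factors Rel X Y Z"
    and "relation_factors Rel Xb Yb Zb"
    and "opposite_sides Rel (X @ Y @ Z) (Xb @ Yb @ Zb)"
    and "u \<in> lists A"
    and "v \<in> lists A"
    and "u = X @ Y @ u'"
    and "overlap_prefix Rel (X @ Y) u"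
    and "clean Rel [] X Y u"
  shows
    "let
       c1 = (\<exists>u'' v''. u = X @ Y @ Z @ u'' \<and> v = X @ Y @ Z @ v'' \<and>
              (pres_eq A Rel (Z @ u'') (Z @ v'') \<or> pres_eq A Rel (Zb @ u'') (Zb @ v'')));
       c2 = (\<exists>v'. u = X @ Y @ u' \<and> v = X @ Y @ v' \<and>
              (\<not> prefix Z u' \<or> \<not> prefix Z v') \<and> pres_eq A Rel u' v');
       c3 = (\<exists>u'' v''. u = X @ Y @ Z @ u'' \<and> v = Xb @ Yb @ Zb @ v'' \<and>
              (pres_eq A Rel (Z @ u'') (Z @ v'') \<or> pres_eq A Rel (Zb @ u'') (Zb @ v'')));
       c4 = (\<exists>v''. u = X @ Y @ u' \<and> v = Xb @ Yb @ Zb @ v'' \<and>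
              \<not> prefix Z u' \<and> pres_eq A Rel u' (Z @ v''));
       c5 = (\<exists>u'' v'. u = X @ Y @ Z @ u'' \<and> v = Xb @ Yb @ v' \<and>
              \<not> prefix Zb v' \<and> pres_eq A Rel (Zb @ u'') v');
       c6 = (\<exists>v' u'' v'' z1 z2 z. u = X @ Y @ u' \<and> v = Xb @ Yb @ v' \<and>
              \<not> prefix Z u' \<and> \<not> prefix Zb v' \<and>
              Z = z1 @ z \<and> Zb = z2 @ z \<and> u' = z1 @ u'' \<and> v' = z2 @ v'' \<and>
              pres_eq A Rel u'' v'' \<and> max_common_suffix z Z Zb \<and> z \<noteq> [] \<and>
              possible_prefix A Rel z u'')
     in (pres_eq A Rel u v \<longleftrightarrow> c1 \<or> c2 \<or> c3 \<or> c4 \<or> c5 \<or> c6) \<and>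
        sorted_wrt (\<lambda>c d. \<not> (c \<and> d)) [c1, c2, c3, c4, c5, c6]"
proof -
  interpret c4 Rel by unfold_locales (rule assms(2))
  note iff = pres_eq_iff_rewrite_eq[OF assms(1)]
  have fr: "factored_relation X Y Z Xb Yb Zb"
    using assms(3-5) by (simp add: factored_relation_def)
  have "Xb @ Yb @ Zb \<in> lists A"
    using assms(1,5) unfolding finite_presentation_def opposite_sides_def by blast
  then have Zb: "Zb \<in> lists A" by simp
  have u': "X @ Y \<in> lists A" "u' \<in> lists A" using assms(6,8) by auto
  have Z: "Z \<in> lists A"
  proof -
    have "X @ Y @ Z \<in> lists A"
      using assms(1,5) unfolding finite_presentation_def opposite_sides_def by blast
    then show ?thesis by simp
  qed
  let ?c1 = "\<exists>u'' v''. u = X @ Y @ Z @ u'' \<and> v = X @ Y @ Z @ v'' \<and>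
    (pres_eq A Rel (Z @ u'') (Z @ v'') \<or> pres_eq A Rel (Zb @ u'') (Zb @ v''))"
  let ?c2 = "\<exists>v'. u = X @ Y @ u' \<and> v = X @ Y @ v' \<and>
    (\<not> prefix Z u' \<or> \<not> prefix Z v') \<and> pres_eq A Rel u' v'"
  let ?c3 = "\<exists>u'' v''. u = X @ Y @ Z @ u'' \<and> v = Xb @ Yb @ Zb @ v'' \<and>
    (pres_eq A Rel (Z @ u'') (Z @ v'') \<or> pres_eq A Rel (Zb @ u'') (Zb @ v''))"
  let ?c4 = "\<exists>v''. u = X @ Y @ u' \<and> v = Xb @ Yb @ Zb @ v'' \<and>
    \<not> prefix Z u' \<and> pres_eq A Rel u' (Z @ v'')"
  let ?c5 = "\<exists>u'' v'. u = X @ Y @ Z @ u'' \<and> v = Xb @ Yb @ v' \<and>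
    \<not> prefix Zb v' \<and> pres_eq A Rel (Zb @ u'') v'"
  let ?c6 = "\<exists>v' u'' v'' z1 z2 z. u = X @ Y @ u' \<and> v = Xb @ Yb @ v' \<and>
    \<not> prefix Z u' \<and> \<not> prefix Zb v' \<and>
    Z = z1 @ z \<and> Zb = z2 @ z \<and> u' = z1 @ u'' \<and> v' = z2 @ v'' \<and>
    pres_eq A Rel u'' v'' \<and> max_common_suffix z Z Zb \<and> z \<noteq> [] \<and>
    possible_prefix A Rel z u''"
  have tail: "pres_eq A Rel (Z @ a) (Z @ b) \<or> pres_eq A Rel (Zb @ a) (Zb @ b) \<longleftrightarrow> tail_step Z Zb a b"
    if "a \<in> lists A" "b \<in> lists A" for a b
    using that Z Zb by (simp add: iff tail_step_def)
  have tail_imp: "tail_step Z Zb a b"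
    if "pres_eq A Rel (Z @ a) (Z @ b) \<or> pres_eq A Rel (Zb @ a) (Zb @ b)" for a b
    using that by (auto simp: iff tail_step_def)
  have "pres_eq A Rel u v \<longleftrightarrow> ?c1 \<or> ?c2 \<or> ?c3 \<or> ?c4 \<or> ?c5 \<or> ?c6"
  proof
    assume "pres_eq A Rel u v"
    then have "rewrite_eq Rel (X @ Y @ u') v" using assms(8) by (simp add: iff)
    moreover have "clean Rel [] X Y (X @ Y @ u')" using assms(8,10) by simp
    ultimately have "(\<exists>u'' v''. u' = Z @ u'' \<and> v = X @ Y @ Z @ v'' \<and> tail_step Z Zb u'' v'') \<or>
      (\<exists>v'. v = X @ Y @ v' \<and> (\<not> prefix Z u' \<or> \<not> prefix Z v') \<and> rewrite_eq Rel u' v') \<or>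
      (\<exists>u'' v''. u' = Z @ u'' \<and> v = Xb @ Yb @ Zb @ v'' \<and> tail_step Z Zb u'' v'') \<or>
      (\<exists>v''. v = Xb @ Yb @ Zb @ v'' \<and> \<not> prefix Z u' \<and> rewrite_eq Rel u' (Z @ v'')) \<or>
      (\<exists>u'' v'. u' = Z @ u'' \<and> v = Xb @ Yb @ v' \<and> \<not> prefix Zb v' \<and>
        rewrite_eq Rel (Zb @ u'') v') \<or>
      (\<exists>v' u'' v'' z1 z2 z w. v = Xb @ Yb @ v' \<and> \<not> prefix Z u' \<and> \<not> prefix Zb v' \<and>
         Z = z1 @ z \<and> Zb = z2 @ z \<and> u' = z1 @ u'' \<and> v' = z2 @ v'' \<and> rewrite_eq Rel u'' v'' \<and>
         max_common_suffix z Z Zb \<and> z \<noteq> [] \<and> rewrite_eq Rel (z @ w) u'')"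
      using rewrites_of_clean_prefix[OF fr] by blast
    then show "?c1 \<or> ?c2 \<or> ?c3 \<or> ?c4 \<or> ?c5 \<or> ?c6"
    \<comment> \<open>Only disjunctions of existential statements are split, so the one about
      prefixes in condition (2) stays whole.\<close>
    proof (elim disjE[where P = "Ex P" for P] exE conjE)
      fix u'' v'' assume a: "u' = Z @ u''" "v = X @ Y @ Z @ v''" "tail_step Z Zb u'' v''"
      then have "u'' \<in> lists A" "v'' \<in> lists A" using u' assms(7) by auto
      then have ?c1 using a tail assms(8) by blast
      then show ?thesis by blast
    next
      fix v' assume a: "v = X @ Y @ v'" "\<not> prefix Z u' \<or> \<not> prefix Z v'" "rewrite_eq Rel u' v'"
      then have "pres_eq A Rel u' v'" using u' assms(7) by (simp add: iff)
      then have ?c2 using a assms(8) by blast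
      then show ?thesis by blast
    next
      fix u'' v'' assume a: "u' = Z @ u''" "v = Xb @ Yb @ Zb @ v''" "tail_step Z Zb u'' v''"
      then have "u'' \<in> lists A" "v'' \<in> lists A" using u' assms(7) by auto
      then have ?c3 using a tail assms(8) by blast
      then show ?thesis by blast
    next
      fix v'' assume a: "v = Xb @ Yb @ Zb @ v''" "\<not> prefix Z u'" "rewrite_eq Rel u' (Z @ v'')"
      then have "pres_eq A Rel u' (Z @ v'')" using u' assms(7) Z by (simp add: iff)
      then have ?c4 using a assms(8) by blast
      then show ?thesis by blast
    next
      fix u'' v' assume a: "u' = Z @ u''" "v = Xb @ Yb @ v'" "\<not> prefix Zb v'"
        "rewrite_eq Rel (Zb @ u'') v'"
      then have "pres_eq A Rel (Zb @ u'') v'" using u' assms(7) Zb by (simp add: iff)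
      then have ?c5 using a assms(8) by blast
      then show ?thesis by blast
    next
      fix v' u'' v'' z1 z2 z w
      assume a: "v = Xb @ Yb @ v'" "\<not> prefix Z u'" "\<not> prefix Zb v'"
         "Z = z1 @ z" "Zb = z2 @ z" "u' = z1 @ u''" "v' = z2 @ v''" "rewrite_eq Rel u'' v''"
         "max_common_suffix z Z Zb" "z \<noteq> []" "rewrite_eq Rel (z @ w) u''"
      have l: "u'' \<in> lists A" "v'' \<in> lists A" using a(1,6,7) u' assms(7) by auto
      then have "z @ w \<in> lists A"
        using rewrite_eq_lists[OF assms(1) rewrite_eq_sym[OF a(11)]] by blast
      then have "possible_prefix A Rel z u''"
        unfolding possible_prefix_def iff using a(11) l by auto
      moreover have "pres_eq A Rel u'' v''" using a(8) l by (simp add: iff)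
      ultimately have ?c6 using a assms(8) by blast
      then show ?thesis by blast
    qed
  next
    assume "?c1 \<or> ?c2 \<or> ?c3 \<or> ?c4 \<or> ?c5 \<or> ?c6"
    then have "rewrite_eq Rel u v"
    proof (elim disjE[where P = "Ex P" for P] exE conjE)
      fix v' assume "u = X @ Y @ u'" "v = X @ Y @ v'" "pres_eq A Rel u' v'"
      then show ?thesis using rewrite_eq_append_left[of Rel u' v' "X @ Y"] by (simp add: iff)
    next
      fix v'' assume "u = X @ Y @ u'" "v = Xb @ Yb @ Zb @ v''" "pres_eq A Rel u' (Z @ v'')"
      moreover from this have "rewrite_eq Rel (Z @ v'') u'" using rewrite_eq_sym by (auto simp: iff)
      ultimately show ?thesis using eqv_via_opposite[OF fr] by blast
    next
      fix u'' v' assume "u = X @ Y @ Z @ u''" "v = Xb @ Yb @ v'" "pres_eq A Rel (Zb @ u'') v'"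
      then show ?thesis using eqv_via_opposite[OF fr, of u''] by (simp add: iff)
    next
      fix v' u'' v'' z1 z2 z
      assume a: "u = X @ Y @ u'" "v = Xb @ Yb @ v'" "Z = z1 @ z" "Zb = z2 @ z" "u' = z1 @ u''"
        "v' = z2 @ v''" "pres_eq A Rel u'' v''" "possible_prefix A Rel z u''"
      \<comment> \<open>The completion \<open>w\<close> of the possible prefix \<open>z\<close> is
        the common tail: prepending \<open>z1\<close> and \<open>z2\<close> gives \<open>u'\<close>
        and \<open>v'\<close>.\<close>
      then obtain w where w: "rewrite_eq Rel (z @ w) u''" by (auto simp: possible_prefix_def iff)
      then have "rewrite_eq Rel (z @ w) v''" using a(7) by (auto simp: iff intro: rtranclp_trans)
      then have "rewrite_eq Rel (Z @ w) u'" "rewrite_eq Rel (Zb @ w) v'"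
        using w a rewrite_eq_append_left by fastforce+
      then show ?thesis using eqv_via_opposite[OF fr] a(1,2) by simp
    qed (use tail_imp eqv_of_tail_step[OF fr] in blast)+
    then show "pres_eq A Rel u v" using assms(6,7) by (simp add: iff)
  qed
  moreover have "sorted_wrt (\<lambda>c d. \<not> (c \<and> d)) [?c1, ?c2, ?c3, ?c4, ?c5, ?c6]"
  proof -
    \<comment> \<open>\<open>v\<close> starts with at most one of \<open>X @ Y\<close> and
      \<open>Xb @ Yb\<close>; within each group, the conditions differ in whether \<open>u'\<close>
      starts with \<open>Z\<close> and \<open>v'\<close> with \<open>Z\<close> or
      \<open>Zb\<close>.\<close>
    have "\<not> (\<exists>s s'. v = X @ Y @ s \<and> v = Xb @ Yb @ s')"
      using prefix_middle_incomparable[OF fr] by metis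
    moreover have "prefix Z u' \<longleftrightarrow> (\<exists>u''. u = X @ Y @ Z @ u'')"
      using assms(8) by (auto simp: prefix_def)
    moreover have "prefix Z v' \<longleftrightarrow> (\<exists>v''. v = X @ Y @ Z @ v'')" if "v = X @ Y @ v'" for v'
      using that by (auto simp: prefix_def)
    moreover have "prefix Zb v' \<longleftrightarrow> (\<exists>v''. v = Xb @ Yb @ Zb @ v'')" if "v = Xb @ Yb @ v'" for v'
      using that by (auto simp: prefix_def)
    ultimately show ?thesis unfolding sorted_wrt.simps list.set ball_simps by blast
  qed
  ultimately show ?thesis unfolding Let_def by (rule conjI)
qed

end
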